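(* Any flat special Kähler manifold $(M,g,J,\nabla)$ with a definite metric $g$ is trivial, i.e. $\nabla=D$, where $D$ is the Levi-Civita connection of $g$.
   Context: A (possibly indefinite) Kähler manifold is a (possibly indefinite) Riemannian manifold $(M,g)$ with a complex structure $J$ which is parallel, $DJ=0$, for the Levi-Civita connection $D$ of $g$, with $g$ Hermitian with respect to $J$. Its Kähler form is $\omega=g(J\cdot,\cdot)$. A special Kähler manifold $(M,g,J,\nabla)$ is a Kähler manifold with a torsionfree flat connection $\nabla$ such that $\nabla\omega=0$ and $(\nabla_XJ)Y=(\nabla_YJ)X$ for all vector fields $X,Y$. It is called flat if $D$ is flat, and trivial if $D$ is flat and $\nabla=D$. *)

theory Defs
  imports "HOL-Analysis.Analysis" "HOL-Library.Function_Algebras"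
begin

section \<open>Smooth manifolds\<close>

text \<open>For open \<open>S\<close>, \<open>Ck_on k S f\<close> says that \<open>f\<close> is of class \<open>C\<^sup>k\<close> on \<open>S\<close>: in the successor case
  every directional derivative is of class \<open>C\<^sup>k\<close>.\<close>

primrec Ck_on ::
  "nat \<Rightarrow> 'a::real_normed_vector set \<Rightarrow> ('a \<Rightarrow> 'b::real_normed_vector) \<Rightarrow> bool" where
  "Ck_on 0 S f \<longleftrightarrow> continuous_on S f"
| "Ck_on (Suc k) S f \<longleftrightarrow>
     (\<forall>x\<in>S. f differentiable (at x)) \<and>
     (\<forall>v. Ck_on k S (\<lambda>x. frechet_derivative f (at x) v))"

definition Cinf_on ::
  "'a::real_normed_vector set \<Rightarrow> ('a \<Rightarrow> 'b::real_normed_vector) \<Rightarrow> bool" where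
  "Cinf_on S f \<longleftrightarrow> (\<forall>k. Ck_on k S f)"

text \<open>A chart is a domain with a coordinate map; only the values of the map on the domain matter.
  The atlas is not required to be maximal. All charts take values in the same Euclidean space
  \<open>'e\<close>, so the dimension is \<open>DIM('e)\<close>.\<close>

record ('a, 'e) mfd =
  top_of :: "'a topology"
  atlas :: "('a set \<times> ('a \<Rightarrow> 'e)) set"

abbreviation points :: "('a, 'e) mfd \<Rightarrow> 'a set" where
  "points M \<equiv> topspace (top_of M)"

definition smooth_manifold :: "('a, 'e::euclidean_space) mfd \<Rightarrow> bool" where
  "smooth_manifold M \<longleftrightarrow>
     Hausdorff_space (top_of M) \<and> second_countable (top_of M) \<and>
     (\<Union>(U, \<phi>)\<in>atlas M. U) = points M \<and>
     (\<forall>(U, \<phi>)\<in>atlas M. openin (top_of M) U \<and> open (\<phi> ` U) \<and>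
        homeomorphic_map (subtopology (top_of M) U) (top_of_set (\<phi> ` U)) \<phi>) \<and>
     (\<forall>(U, \<phi>)\<in>atlas M. \<forall>(V, \<psi>)\<in>atlas M.
        Cinf_on (\<phi> ` (U \<inter> V)) (\<psi> \<circ> inv_into U \<phi>))"

text \<open>Functions, tangent vectors and vector fields are total functions in HOL. To make equality
  of them the intended one, all are required to vanish outside their domain.\<close>

definition smooth_functions :: "('a, 'e::euclidean_space) mfd \<Rightarrow> ('a \<Rightarrow> real) set" where
  "smooth_functions M =
     {f. (\<forall>(U, \<phi>)\<in>atlas M. Cinf_on (\<phi> ` U) (f \<circ> inv_into U \<phi>)) \<and>
         (\<forall>p. p \<notin> points M \<longrightarrow> f p = 0)}"


section \<open>Tangent vectors and vector fields\<close>

type_synonym 'a tvec = "('a \<Rightarrow> real) \<Rightarrow> real"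
type_synonym 'a vfield = "'a \<Rightarrow> 'a tvec"

text \<open>Tangent vectors at \<open>p\<close> are the derivations at \<open>p\<close> of the algebra of smooth functions.\<close>

definition tangent_space :: "('a, 'e::euclidean_space) mfd \<Rightarrow> 'a \<Rightarrow> 'a tvec set" where
  "tangent_space M p =
     {v. (\<forall>f\<in>smooth_functions M. \<forall>h\<in>smooth_functions M.
            v (f + h) = v f + v h \<and>
            v (f * h) = f p * v h + h p * v f) \<and>
         (\<forall>c. \<forall>f\<in>smooth_functions M. v (\<lambda>q. c * f q) = c * v f) \<and>
         (\<forall>f. f \<notin> smooth_functions M \<longrightarrow> v f = 0)}"

definition scale_tvec :: "real \<Rightarrow> 'a tvec \<Rightarrow> 'a tvec" where
  "scale_tvec c v = (\<lambda>f. c * v f)"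

definition vderiv :: "'a vfield \<Rightarrow> ('a \<Rightarrow> real) \<Rightarrow> 'a \<Rightarrow> real" where
  "vderiv X f = (\<lambda>p. X p f)"

definition vector_fields :: "('a, 'e::euclidean_space) mfd \<Rightarrow> 'a vfield set" where
  "vector_fields M =
     {X. (\<forall>p\<in>points M. X p \<in> tangent_space M p) \<and>
         (\<forall>p. p \<notin> points M \<longrightarrow> X p = 0) \<and>
         (\<forall>f\<in>smooth_functions M. vderiv X f \<in> smooth_functions M)}"

definition scale_vfield :: "('a \<Rightarrow> real) \<Rightarrow> 'a vfield \<Rightarrow> 'a vfield" where
  "scale_vfield f X = (\<lambda>p. scale_tvec (f p) (X p))"

definition lie_bracket ::
  "('a, 'e::euclidean_space) mfd \<Rightarrow> 'a vfield \<Rightarrow> 'a vfield \<Rightarrow> 'a vfield" where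
  "lie_bracket M X Y =
     (\<lambda>p f. if f \<in> smooth_functions M then X p (vderiv Y f) - Y p (vderiv X f) else 0)"


section \<open>Tensor fields\<close>

type_synonym 'a bilin_field = "'a \<Rightarrow> 'a tvec \<Rightarrow> 'a tvec \<Rightarrow> real"
type_synonym 'a endo_field = "'a \<Rightarrow> 'a tvec \<Rightarrow> 'a tvec"

definition eval_bilin ::
  "('a, 'e) mfd \<Rightarrow> 'a bilin_field \<Rightarrow> 'a vfield \<Rightarrow> 'a vfield \<Rightarrow> 'a \<Rightarrow> real" where
  "eval_bilin M b X Y = (\<lambda>p. if p \<in> points M then b p (X p) (Y p) else 0)"

definition apply_endo ::
  "('a, 'e) mfd \<Rightarrow> 'a endo_field \<Rightarrow> 'a vfield \<Rightarrow> 'a vfield" where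
  "apply_endo M J X = (\<lambda>p. if p \<in> points M then J p (X p) else 0)"

definition smooth_bilin_field :: "('a, 'e::euclidean_space) mfd \<Rightarrow> 'a bilin_field \<Rightarrow> bool" where
  "smooth_bilin_field M b \<longleftrightarrow>
     (\<forall>p\<in>points M. \<forall>u\<in>tangent_space M p. \<forall>v\<in>tangent_space M p. \<forall>w\<in>tangent_space M p. \<forall>c.
        b p (u + v) w = b p u w + b p v w \<and> b p (scale_tvec c u) w = c * b p u w \<and>
        b p w (u + v) = b p w u + b p w v \<and> b p w (scale_tvec c u) = c * b p w u) \<and>
     (\<forall>X\<in>vector_fields M. \<forall>Y\<in>vector_fields M. eval_bilin M b X Y \<in> smooth_functions M)"

definition smooth_endo_field :: "('a, 'e::euclidean_space) mfd \<Rightarrow> 'a endo_field \<Rightarrow> bool" where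
  "smooth_endo_field M J \<longleftrightarrow>
     (\<forall>p\<in>points M. \<forall>u\<in>tangent_space M p. \<forall>v\<in>tangent_space M p. \<forall>c.
        J p u \<in> tangent_space M p \<and>
        J p (u + v) = J p u + J p v \<and> J p (scale_tvec c u) = scale_tvec c (J p u)) \<and>
     (\<forall>X\<in>vector_fields M. apply_endo M J X \<in> vector_fields M)"

text \<open>Possibly indefinite Riemannian metrics.\<close>

definition metric :: "('a, 'e::euclidean_space) mfd \<Rightarrow> 'a bilin_field \<Rightarrow> bool" where
  "metric M g \<longleftrightarrow>
     smooth_bilin_field M g \<and>
     (\<forall>p\<in>points M. \<forall>u\<in>tangent_space M p. \<forall>v\<in>tangent_space M p. g p u v = g p v u) \<and>
     (\<forall>p\<in>points M. \<forall>u\<in>tangent_space M p. (\<forall>v\<in>tangent_space M p. g p u v = 0) \<longrightarrow> u = 0)"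

definition definite :: "('a, 'e::euclidean_space) mfd \<Rightarrow> 'a bilin_field \<Rightarrow> bool" where
  "definite M g \<longleftrightarrow>
     (\<forall>p\<in>points M. \<forall>u\<in>tangent_space M p. u \<noteq> 0 \<longrightarrow> g p u u > 0) \<or>
     (\<forall>p\<in>points M. \<forall>u\<in>tangent_space M p. u \<noteq> 0 \<longrightarrow> g p u u < 0)"


section \<open>Connections\<close>

type_synonym 'a conn = "'a vfield \<Rightarrow> 'a vfield \<Rightarrow> 'a vfield"

text \<open>The second conjunct again fixes the values outside the domain, so that equality of
  connections is plain equality of functions.\<close>

definition connection :: "('a, 'e::euclidean_space) mfd \<Rightarrow> 'a conn \<Rightarrow> bool" where
  "connection M D \<longleftrightarrow>
     (\<forall>X\<in>vector_fields M. \<forall>Y\<in>vector_fields M. D X Y \<in> vector_fields M) \<and>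
     (\<forall>X Y. X \<notin> vector_fields M \<or> Y \<notin> vector_fields M \<longrightarrow> D X Y = 0) \<and>
     (\<forall>X\<in>vector_fields M. \<forall>Y\<in>vector_fields M. \<forall>Z\<in>vector_fields M.
        D (X + Y) Z = D X Z + D Y Z \<and> D X (Y + Z) = D X Y + D X Z) \<and>
     (\<forall>f\<in>smooth_functions M. \<forall>X\<in>vector_fields M. \<forall>Y\<in>vector_fields M.
        D (scale_vfield f X) Y = scale_vfield f (D X Y) \<and>
        D X (scale_vfield f Y) = scale_vfield (vderiv X f) Y + scale_vfield f (D X Y))"

definition torsion_free :: "('a, 'e::euclidean_space) mfd \<Rightarrow> 'a conn \<Rightarrow> bool" where
  "torsion_free M D \<longleftrightarrow>
     (\<forall>X\<in>vector_fields M. \<forall>Y\<in>vector_fields M. D X Y - D Y X = lie_bracket M X Y)"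

definition curvature ::
  "('a, 'e::euclidean_space) mfd \<Rightarrow> 'a conn \<Rightarrow> 'a vfield \<Rightarrow> 'a vfield \<Rightarrow> 'a vfield \<Rightarrow> 'a vfield" where
  "curvature M D X Y Z = D X (D Y Z) - D Y (D X Z) - D (lie_bracket M X Y) Z"

definition flat_connection :: "('a, 'e::euclidean_space) mfd \<Rightarrow> 'a conn \<Rightarrow> bool" where
  "flat_connection M D \<longleftrightarrow>
     (\<forall>X\<in>vector_fields M. \<forall>Y\<in>vector_fields M. \<forall>Z\<in>vector_fields M. curvature M D X Y Z = 0)"

definition cov_bilin ::
  "('a, 'e) mfd \<Rightarrow> 'a conn \<Rightarrow> 'a bilin_field \<Rightarrow>
     'a vfield \<Rightarrow> 'a vfield \<Rightarrow> 'a vfield \<Rightarrow> 'a \<Rightarrow> real" where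
  "cov_bilin M D b X Y Z =
     vderiv X (eval_bilin M b Y Z) - eval_bilin M b (D X Y) Z - eval_bilin M b Y (D X Z)"

definition cov_endo ::
  "('a, 'e) mfd \<Rightarrow> 'a conn \<Rightarrow> 'a endo_field \<Rightarrow> 'a vfield \<Rightarrow> 'a vfield \<Rightarrow> 'a vfield" where
  "cov_endo M D J X Y = D X (apply_endo M J Y) - apply_endo M J (D X Y)"

definition parallel_bilin ::
  "('a, 'e::euclidean_space) mfd \<Rightarrow> 'a conn \<Rightarrow> 'a bilin_field \<Rightarrow> bool" where
  "parallel_bilin M D b \<longleftrightarrow>
     (\<forall>X\<in>vector_fields M. \<forall>Y\<in>vector_fields M. \<forall>Z\<in>vector_fields M. cov_bilin M D b X Y Z = 0)"

definition parallel_endo ::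
  "('a, 'e::euclidean_space) mfd \<Rightarrow> 'a conn \<Rightarrow> 'a endo_field \<Rightarrow> bool" where
  "parallel_endo M D J \<longleftrightarrow>
     (\<forall>X\<in>vector_fields M. \<forall>Y\<in>vector_fields M. cov_endo M D J X Y = 0)"

definition levi_civita ::
  "('a, 'e::euclidean_space) mfd \<Rightarrow> 'a bilin_field \<Rightarrow> 'a conn \<Rightarrow> bool" where
  "levi_civita M g D \<longleftrightarrow> connection M D \<and> torsion_free M D \<and> parallel_bilin M D g"


section \<open>Special Kaehler manifolds\<close>

text \<open>Integrability of \<open>J\<close> is not listed: it follows from \<open>D J = 0\<close>, as \<open>D\<close> is torsion-free.\<close>

definition almost_complex_structure ::
  "('a, 'e::euclidean_space) mfd \<Rightarrow> 'a endo_field \<Rightarrow> bool" where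
  "almost_complex_structure M J \<longleftrightarrow>
     smooth_endo_field M J \<and> (\<forall>p\<in>points M. \<forall>u\<in>tangent_space M p. J p (J p u) = - u)"

definition hermitian ::
  "('a, 'e::euclidean_space) mfd \<Rightarrow> 'a bilin_field \<Rightarrow> 'a endo_field \<Rightarrow> bool" where
  "hermitian M g J \<longleftrightarrow>
     (\<forall>p\<in>points M. \<forall>u\<in>tangent_space M p. \<forall>v\<in>tangent_space M p. g p (J p u) (J p v) = g p u v)"

definition kaehler_form :: "'a bilin_field \<Rightarrow> 'a endo_field \<Rightarrow> 'a bilin_field" where
  "kaehler_form g J = (\<lambda>p u v. g p (J p u) v)"

text \<open>The Levi-Civita connection exists and is unique; \<open>\<exists>D. levi_civita M g D \<and> \<dots>\<close> below
  therefore means that the Levi-Civita connection has the property in question.\<close>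

definition kaehler_manifold ::
  "('a, 'e::euclidean_space) mfd \<Rightarrow> 'a bilin_field \<Rightarrow> 'a endo_field \<Rightarrow> bool" where
  "kaehler_manifold M g J \<longleftrightarrow>
     smooth_manifold M \<and> metric M g \<and> almost_complex_structure M J \<and> hermitian M g J \<and>
     (\<exists>D. levi_civita M g D \<and> parallel_endo M D J)"

definition special_kaehler_manifold ::
  "('a, 'e::euclidean_space) mfd \<Rightarrow> 'a bilin_field \<Rightarrow> 'a endo_field \<Rightarrow> 'a conn \<Rightarrow> bool" where
  "special_kaehler_manifold M g J N \<longleftrightarrow>
     kaehler_manifold M g J \<and>
     connection M N \<and> torsion_free M N \<and> flat_connection M N \<and>
     parallel_bilin M N (kaehler_form g J) \<and>
     (\<forall>X\<in>vector_fields M. \<forall>Y\<in>vector_fields M. cov_endo M N J X Y = cov_endo M N J Y X)"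

definition flat_special_kaehler_manifold ::
  "('a, 'e::euclidean_space) mfd \<Rightarrow> 'a bilin_field \<Rightarrow> 'a endo_field \<Rightarrow> 'a conn \<Rightarrow> bool" where
  "flat_special_kaehler_manifold M g J N \<longleftrightarrow>
     special_kaehler_manifold M g J N \<and> (\<exists>D. levi_civita M g D \<and> flat_connection M D)"

definition trivial_special_kaehler_manifold ::
  "('a, 'e::euclidean_space) mfd \<Rightarrow> 'a bilin_field \<Rightarrow> 'a endo_field \<Rightarrow> 'a conn \<Rightarrow> bool" where
  "trivial_special_kaehler_manifold M g J N \<longleftrightarrow>
     special_kaehler_manifold M g J N \<and>
     (\<exists>D. levi_civita M g D \<and> flat_connection M D \<and> N = D)"

end

theory Submission
  imports Defs
begin

text \<open>Put \<open>S X Y = N X Y - D X Y\<close>. Subtracting the conditions on \<open>N\<close> and \<open>D\<close> shows that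
  \<open>\<omega> (S X Y) Z\<close> is totally symmetric and that every \<open>S X\<close> is \<open>g\<close>-symmetric and anticommutes
  with \<open>J\<close>. In the difference of the two vanishing curvatures, the part \<open>[S X, S Y]\<close> commutes
  with \<open>J\<close> while the part linear in \<open>S\<close> anticommutes with it, so both vanish. As
  \<open>S (J X) = S X \<circ> J\<close>, taking \<open>Y = J X\<close> gives \<open>S X \<circ> S X = 0\<close>, and a symmetric operator of
  square zero with respect to a definite metric is zero. Definiteness also replaces the extension
  of tangent vectors to vector fields in all nondegeneracy arguments.\<close>

section \<open>Hermitian modules\<close>

text \<open>Models vector fields with function-valued products, so the algebra never passes to
  points or charts. Stating the axioms for differences keeps the instances short; \<open>0\<close>,
  negatives and sums follow. \<open>no_2_torsion\<close> stands in for division by two, and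
  \<open>anisotropic\<close> is what definiteness provides.\<close>

locale hermitian_module =
  fixes V :: "'v::ab_group_add set" and J :: "'v \<Rightarrow> 'v" and g :: "'v \<Rightarrow> 'v \<Rightarrow> 'r::ab_group_add"
  assumes V_diff: "\<And>x y. x \<in> V \<Longrightarrow> y \<in> V \<Longrightarrow> x - y \<in> V"
    and J_closed: "\<And>x. x \<in> V \<Longrightarrow> J x \<in> V"
    and J_diff: "\<And>x y. x \<in> V \<Longrightarrow> y \<in> V \<Longrightarrow> J (x - y) = J x - J y"
    and J_J: "\<And>x. x \<in> V \<Longrightarrow> J (J x) = - x"
    and g_diff: "\<And>x y z. x \<in> V \<Longrightarrow> y \<in> V \<Longrightarrow> z \<in> V \<Longrightarrow> g (x - y) z = g x z - g y z"
    and g_commute: "\<And>x y. x \<in> V \<Longrightarrow> y \<in> V \<Longrightarrow> g x y = g y x"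
    and g_J_J: "\<And>x y. x \<in> V \<Longrightarrow> y \<in> V \<Longrightarrow> g (J x) (J y) = g x y"
    and anisotropic: "\<And>x. x \<in> V \<Longrightarrow> g x x = 0 \<Longrightarrow> x = 0"
    and no_2_torsion: "\<And>r::'r. r + r = 0 \<Longrightarrow> r = 0"
begin

lemma V_zero: "x \<in> V \<Longrightarrow> 0 \<in> V"
  using V_diff[of x x] by simp

lemma V_minus: "x \<in> V \<Longrightarrow> - x \<in> V"
  using V_diff[of 0 x] V_zero by simp

lemma V_add: "x \<in> V \<Longrightarrow> y \<in> V \<Longrightarrow> x + y \<in> V"
  using V_diff[of x "- y"] V_minus by simp

lemma J_zero: "x \<in> V \<Longrightarrow> J 0 = 0"
  using J_diff[of x x] by simp

lemma J_minus: "x \<in> V \<Longrightarrow> J (- x) = - J x"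
  using J_diff[of 0 x] V_zero J_zero by simp

lemma J_eq_zero: "x \<in> V \<Longrightarrow> J x = 0 \<Longrightarrow> x = 0"
  using J_J[of x] J_zero by simp

lemma g_zero: "x \<in> V \<Longrightarrow> g 0 x = 0"
  using g_diff[of x x x] by simp

lemma g_minus: "x \<in> V \<Longrightarrow> y \<in> V \<Longrightarrow> g (- x) y = - g x y"
  using g_diff[of 0 x y] V_zero g_zero by simp

text \<open>The single test vector \<open>z = x - y\<close> suffices, by anisotropy.\<close>

lemma g_nondegenerate:
  assumes "x \<in> V" "y \<in> V" "\<And>z. z \<in> V \<Longrightarrow> g x z = g y z"
  shows "x = y"
  using anisotropic[of "x - y"] g_diff[of x y "x - y"] assms V_diff by simp

lemma double_eq_zero:
  assumes "x \<in> V" "x + x = 0"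
  shows "x = 0"
proof -
  have "- x = x"
    using assms(2) by (rule minus_unique)
  then have "g x x + g x x = g x x + - g x x"
    using g_minus[OF assms(1,1)] by simp
  then have "g x x + g x x = 0"
    by (simp only: add.right_inverse)
  then show ?thesis
    using no_2_torsion anisotropic assms(1) by blast
qed

lemma g_J_left: "x \<in> V \<Longrightarrow> y \<in> V \<Longrightarrow> g (J x) y = - g x (J y)"
  using g_J_J[of "J x" y] J_J[of x] g_minus[of x "J y"] J_closed by simp

text \<open>Swapping the first two slots of \<open>g (T a b) c\<close> keeps the sign, swapping the
  last two reverses it. Three rounds of both lead back to the start with the opposite sign. This is
  the algebra behind uniqueness of the Levi-Civita connection.\<close>

lemma symmetric_skew_eq_zero:
  assumes closed: "\<And>x y. x \<in> V \<Longrightarrow> y \<in> V \<Longrightarrow> T x y \<in> V"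
    and sym: "\<And>x y. x \<in> V \<Longrightarrow> y \<in> V \<Longrightarrow> T x y = T y x"
    and skew: "\<And>x y z. x \<in> V \<Longrightarrow> y \<in> V \<Longrightarrow> z \<in> V \<Longrightarrow> g (T x y) z = - g y (T x z)"
    and "x \<in> V" "y \<in> V"
  shows "T x y = 0"
proof -
  have flip: "g (T a b) c = - g (T a c) b" if "a \<in> V" "b \<in> V" "c \<in> V" for a b c
    using skew[of a b c] g_commute[of b "T a c"] closed that by simp
  have "g (T a b) c = - g (T a b) c" if V: "a \<in> V" "b \<in> V" "c \<in> V" for a b c
  proof -
    have "g (T a b) c = - g (T c a) b"
      using flip[of a b c] sym[of a c] V by simp
    also have "\<dots> = g (T b c) a"
      using flip[of c a b] sym[of b c] V by simp
    also have "\<dots> = - g (T a b) c"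
      using flip[of b c a] sym[of a b] V by simp
    finally show ?thesis .
  qed
  \<comment> \<open>The third slot is filled with \<open>T x y\<close> itself, so that anisotropy
    applies.\<close>
  from this[OF assms(4,5) closed[OF assms(4,5)]]
  have "g (T x y) (T x y) + g (T x y) (T x y) = 0"
    by (simp only: eq_neg_iff_add_eq_0)
  then show ?thesis
    using no_2_torsion anisotropic closed assms(4,5) by blast
qed

end

text \<open>\<open>S\<close> models the difference of the special and the Levi-Civita connection.
  \<open>S_commute\<close> reflects vanishing torsion, \<open>S_J_commute\<close> the symmetry of
  the covariant derivative of \<open>J\<close>, and \<open>S_symplectic\<close> that the Kaehler
  form is parallel.\<close>

locale special_hermitian_module = hermitian_module V J g
  for V :: "'v::ab_group_add set" and J and g :: "'v \<Rightarrow> 'v \<Rightarrow> 'r::ab_group_add" +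
  fixes S :: "'v \<Rightarrow> 'v \<Rightarrow> 'v"
  assumes S_closed: "\<And>x y. x \<in> V \<Longrightarrow> y \<in> V \<Longrightarrow> S x y \<in> V"
    and S_diff: "\<And>x y z. x \<in> V \<Longrightarrow> y \<in> V \<Longrightarrow> z \<in> V \<Longrightarrow> S x (y - z) = S x y - S x z"
    and S_commute: "\<And>x y. x \<in> V \<Longrightarrow> y \<in> V \<Longrightarrow> S x y = S y x"
    and S_J_commute: "\<And>x y. x \<in> V \<Longrightarrow> y \<in> V \<Longrightarrow> S x (J y) = S y (J x)"
    and S_symplectic: "\<And>x y z. x \<in> V \<Longrightarrow> y \<in> V \<Longrightarrow> z \<in> V \<Longrightarrow>
          g (J (S x y)) z = - g (J y) (S x z)"
begin

section \<open>Symmetries of the cubic form of the difference tensor\<close>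

lemma S_zero: "x \<in> V \<Longrightarrow> S x 0 = 0"
  using S_diff[of x x x] by simp

lemma S_minus: "x \<in> V \<Longrightarrow> y \<in> V \<Longrightarrow> S x (- y) = - S x y"
  using S_diff[of x 0 y] V_zero S_zero by simp

text \<open>The Kaehler form is itself skew, which turns the skewness in \<open>S_symplectic\<close>
  into symmetry. Together with \<open>S_commute\<close> the cubic form becomes totally
  symmetric.\<close>

lemma cubic_form_swap:
  assumes "x \<in> V" "y \<in> V" "z \<in> V"
  shows "g (J (S x y)) z = g (J (S x z)) y"
  using S_symplectic[of x y z] g_J_left[of y "S x z"] g_commute[of y "J (S x z)"]
    S_closed J_closed assms by simp

text \<open>Total symmetry brings \<open>y\<close> and \<open>J z\<close> together as the arguments
  of \<open>S\<close>, where \<open>S_J_commute\<close> moves \<open>J\<close> from one to the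
  other; then the slots are permuted back.\<close>

lemma cubic_form_J:
  assumes V: "x \<in> V" "y \<in> V" "z \<in> V"
  shows "g (J (S x y)) (J z) = g (J (S x (J y))) z"
proof -
  have "g (J (S x y)) (J z) = g (J (S y x)) (J z)"
    using S_commute[of x y] V by simp
  also have "\<dots> = g (J (S y (J z))) x"
    using cubic_form_swap[of y x "J z"] V J_closed by simp
  also have "\<dots> = g (J (S (J y) z)) x"
    using S_J_commute[of y z] S_commute[of z "J y"] V J_closed by simp
  also have "\<dots> = g (J (S (J y) x)) z"
    using cubic_form_swap[of "J y" z x] V J_closed by simp
  also have "\<dots> = g (J (S x (J y))) z"
    using S_commute[of x "J y"] V J_closed by simp
  finally show ?thesis .
qed

lemma J_S_J:
  assumes V: "x \<in> V" "y \<in> V"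
  shows "J (S x (J y)) = S x y"
proof (rule g_nondegenerate)
  fix z assume "z \<in> V"
  then show "g (J (S x (J y))) z = g (S x y) z"
    using cubic_form_J[of x y z] g_J_J[of "S x y" z] S_closed V by simp
qed (use V S_closed J_closed in auto)

lemma S_J:
  assumes V: "x \<in> V" "y \<in> V"
  shows "S x (J y) = - J (S x y)"
  using J_S_J[OF V] J_J[of "S x (J y)"] S_closed J_closed V
  by simp

text \<open>Up to a \<open>J\<close> in the last slot this is the cubic form; after the swap,
  \<open>J_S_J\<close> absorbs both copies of \<open>J\<close>.\<close>

lemma S_symmetric:
  assumes V: "x \<in> V" "y \<in> V" "z \<in> V"
  shows "g (S x y) z = g (S x z) y"
proof -
  have "g (S x y) z = g (J (S x y)) (J z)"
    using g_J_J[of "S x y" z] S_closed V by simp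
  also have "\<dots> = g (J (S x (J z))) y"
    using cubic_form_swap[of x y "J z"] V J_closed by simp
  finally show ?thesis
    using J_S_J V by simp
qed

lemma commuting_imp_zero:
  assumes comm: "\<And>x y z. x \<in> V \<Longrightarrow> y \<in> V \<Longrightarrow> z \<in> V \<Longrightarrow> S x (S y z) = S y (S x z)"
    and V: "x \<in> V" "z \<in> V"
  shows "S x z = 0"
proof -
  have S_left_J: "S (J x) w = - J (S x w)" if "w \<in> V" for w
    using S_commute[of "J x" w] S_J_commute[of w x] S_J[of x w] J_closed V that by simp
  \<comment> \<open>Pulling \<open>J\<close> out to the left costs two signs here, but only one when
    \<open>S (J x)\<close> is the outer operator.\<close>
  have "S x (S (J x) z) = J (S x (S x z))"
    using S_left_J[of z] S_minus[of x "J (S x z)"] S_J[of x "S x z"] S_closed J_closed V by simp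
  moreover have "S (J x) (S x z) = - J (S x (S x z))"
    using S_left_J[of "S x z"] S_closed V by simp
  ultimately have "J (S x (S x z)) = - J (S x (S x z))"
    using comm[of x "J x" z] J_closed V by simp
  then have "J (S x (S x z)) + J (S x (S x z)) = 0"
    by (simp only: eq_neg_iff_add_eq_0)
  from double_eq_zero[OF _ this] have "J (S x (S x z)) = 0"
    using S_closed J_closed V by simp
  from J_eq_zero[OF _ this] have "S x (S x z) = 0"
    using S_closed V by simp
  then have "g (S x z) (S x z) = 0"
    using S_symmetric[of x z "S x z"] g_zero S_closed V by simp
  then show ?thesis
    using anisotropic S_closed V by blast
qed

end

section \<open>Vector fields\<close>

text \<open>On an open set the values near a point determine the derivative there. Both functions
  are generalised because the induction passes to directional derivatives.\<close>

lemma Ck_on_cong: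
  assumes "open S" "\<And>x. x \<in> S \<Longrightarrow> f x = h x" "Ck_on k S f"
  shows "Ck_on k S h"
  using assms(2,3)
proof (induction k arbitrary: f h)
  case 0
  then show ?case
    using continuous_on_cong[of S S f h] by simp
next
  case (Suc k)
  have deriv: "(h has_derivative frechet_derivative f (at x)) (at x)" if "x \<in> S" for x
  proof (rule has_derivative_transform_within_open[OF _ assms(1) that])
    show "(f has_derivative frechet_derivative f (at x)) (at x)"
      using Suc.prems(2) that by (simp add: frechet_derivative_works)
  qed (use Suc.prems(1) in auto)
  have "Ck_on k S (\<lambda>x. frechet_derivative h (at x) v)" for v
  proof (rule Suc.IH)
    show "Ck_on k S (\<lambda>x. frechet_derivative f (at x) v)"
      using Suc.prems(2) by simp
  qed (use deriv frechet_derivative_at in metis)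
  then show ?case
    using deriv by (auto simp: differentiable_def)
qed

lemma Ck_on_diff:
  assumes "open S" "Ck_on k S f" "Ck_on k S h"
  shows "Ck_on k S (\<lambda>x. f x - h x)"
  using assms(2,3)
proof (induction k arbitrary: f h)
  case 0
  then show ?case
    by (simp add: continuous_on_diff)
next
  case (Suc k)
  have "Ck_on k S (\<lambda>x. frechet_derivative (\<lambda>x. f x - h x) (at x) v)" for v
  \<comment> \<open>The derivative of the difference is known only where both functions are
    differentiable, so the two sides are compared on \<open>S\<close> alone.\<close>
  proof (rule Ck_on_cong[OF assms(1)])
    show "Ck_on k S (\<lambda>x. frechet_derivative f (at x) v - frechet_derivative h (at x) v)"
      using Suc by simp
    fix x assume "x \<in> S"
    then have "((\<lambda>x. f x - h x) has_derivative
        (\<lambda>v. frechet_derivative f (at x) v - frechet_derivative h (at x) v)) (at x)"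
      using Suc.prems by (intro has_derivative_diff) (simp_all add: frechet_derivative_works)
    then show "frechet_derivative f (at x) v - frechet_derivative h (at x) v =
        frechet_derivative (\<lambda>x. f x - h x) (at x) v"
      using frechet_derivative_at by metis
  qed
  then show ?case
    using Suc.prems by simp
qed

lemma smooth_functions_diff:
  assumes M: "smooth_manifold M" and f: "f \<in> smooth_functions M" and h: "h \<in> smooth_functions M"
  shows "f - h \<in> smooth_functions M"
proof -
  have "Cinf_on (\<phi> ` U) ((f - h) \<circ> inv_into U \<phi>)" if "(U, \<phi>) \<in> atlas M" for U \<phi>
  proof -
    have "open (\<phi> ` U)"
      using M that by (auto simp: smooth_manifold_def)
    moreover have "Cinf_on (\<phi> ` U) (f \<circ> inv_into U \<phi>)" "Cinf_on (\<phi> ` U) (h \<circ> inv_into U \<phi>)"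
      using f h that by (auto simp: smooth_functions_def)
    ultimately show ?thesis
      using Ck_on_diff[of "\<phi> ` U" _ "f \<circ> inv_into U \<phi>" "h \<circ> inv_into U \<phi>"]
      by (simp add: Cinf_on_def comp_def)
  qed
  then show ?thesis
    using f h by (auto simp: smooth_functions_def)
qed

section \<open>Vector fields and tensor fields under subtraction\<close>

lemma tangent_space_diff:
  "u \<in> tangent_space M p \<Longrightarrow> v \<in> tangent_space M p \<Longrightarrow> u - v \<in> tangent_space M p"
  by (simp add: tangent_space_def algebra_simps)

lemma vector_fields_diff:
  assumes "smooth_manifold M" "X \<in> vector_fields M" "Y \<in> vector_fields M"
  shows "X - Y \<in> vector_fields M"
proof -
  have "vderiv (X - Y) f = vderiv X f - vderiv Y f" for f
    by (simp add: vderiv_def fun_eq_iff)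
  then show ?thesis
    using assms by (simp add: vector_fields_def tangent_space_diff smooth_functions_diff)
qed

lemma vector_field_tangent: "X \<in> vector_fields M \<Longrightarrow> p \<in> points M \<Longrightarrow> X p \<in> tangent_space M p"
  by (simp add: vector_fields_def)

lemma smooth_endo_field_diff:
  assumes "smooth_endo_field M J" "p \<in> points M" "u \<in> tangent_space M p" "v \<in> tangent_space M p"
  shows "J p (u - v) = J p u - J p v"
proof -
  have "\<forall>u\<in>tangent_space M p. \<forall>v\<in>tangent_space M p. J p (u + v) = J p u + J p v"
    using assms(1,2) by (simp add: smooth_endo_field_def)
  \<comment> \<open>Additivity is applied to \<open>u - v\<close> and \<open>v\<close>, whose sum is
    \<open>u\<close>.\<close>
  from this[rule_format, OF tangent_space_diff[OF assms(3,4)] assms(4)]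
  show ?thesis by simp
qed

lemma smooth_bilin_field_diff:
  assumes "smooth_bilin_field M b" "p \<in> points M"
    and "u \<in> tangent_space M p" "v \<in> tangent_space M p" "w \<in> tangent_space M p"
  shows "b p (u - v) w = b p u w - b p v w"
proof -
  have "\<forall>u\<in>tangent_space M p. \<forall>v\<in>tangent_space M p. b p (u + v) w = b p u w + b p v w"
    using assms(1,2,5) by (simp add: smooth_bilin_field_def)
  from this[rule_format, OF tangent_space_diff[OF assms(3,4)] assms(4)]
  show ?thesis by simp
qed

text \<open>Reduces conditions on the Kaehler form to the product \<open>eval_bilin M g\<close> used
  in the locales.\<close>

lemma kaehler_form_eval:
  "eval_bilin M (kaehler_form g J) X Y = eval_bilin M g (apply_endo M J X) Y"
  by (simp add: eval_bilin_def kaehler_form_def apply_endo_def fun_eq_iff)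

lemma definite_hermitian_module:
  fixes M :: "('a, 'e::euclidean_space) mfd"
  assumes M: "smooth_manifold M" and g: "metric M g" and J: "almost_complex_structure M J"
    and herm: "hermitian M g J" and def: "definite M g"
  shows "hermitian_module (vector_fields M) (apply_endo M J) (eval_bilin M g)"
proof
  note tan = vector_field_tangent
  have Js: "smooth_endo_field M J" and gs: "smooth_bilin_field M g"
    using J g by (auto simp: almost_complex_structure_def metric_def)
  show "X - Y \<in> vector_fields M" if "X \<in> vector_fields M" "Y \<in> vector_fields M" for X Y
    using vector_fields_diff[OF M that] .
  show "apply_endo M J X \<in> vector_fields M" if "X \<in> vector_fields M" for X
    using Js that by (simp add: smooth_endo_field_def)
  show "apply_endo M J (X - Y) = apply_endo M J X - apply_endo M J Y"
    if "X \<in> vector_fields M" "Y \<in> vector_fields M" for X Y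
    using smooth_endo_field_diff[OF Js] tan[OF that(1)] tan[OF that(2)]
    by (auto simp: apply_endo_def fun_eq_iff)
  show "apply_endo M J (apply_endo M J X) = - X" if "X \<in> vector_fields M" for X
  proof
    fix p
    show "apply_endo M J (apply_endo M J X) p = (- X) p"
      using J tan[OF that, of p] that
      by (simp add: apply_endo_def almost_complex_structure_def vector_fields_def)
  qed
  show "eval_bilin M g (X - Y) Z = eval_bilin M g X Z - eval_bilin M g Y Z"
    if "X \<in> vector_fields M" "Y \<in> vector_fields M" "Z \<in> vector_fields M" for X Y Z
    using smooth_bilin_field_diff[OF gs] tan[OF that(1)] tan[OF that(2)] tan[OF that(3)]
    by (auto simp: eval_bilin_def fun_eq_iff)
  show "eval_bilin M g X Y = eval_bilin M g Y X"
    if "X \<in> vector_fields M" "Y \<in> vector_fields M" for X Y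
    using g tan[OF that(1)] tan[OF that(2)] by (auto simp: eval_bilin_def fun_eq_iff metric_def)
  show "eval_bilin M g (apply_endo M J X) (apply_endo M J Y) = eval_bilin M g X Y"
    if "X \<in> vector_fields M" "Y \<in> vector_fields M" for X Y
    using herm tan[OF that(1)] tan[OF that(2)]
    by (auto simp: eval_bilin_def apply_endo_def fun_eq_iff hermitian_def)
  \<comment> \<open>The only use of definiteness: a vanishing norm function forces
    \<open>X p = 0\<close> at every point of the manifold, and elsewhere vector fields vanish by
    convention.\<close>
  show "X = 0" if X: "X \<in> vector_fields M" and zero: "eval_bilin M g X X = 0" for X
  proof
    fix p
    show "X p = 0 p"
    proof (cases "p \<in> points M")
      case True
      then have "g p (X p) (X p) = 0"
        using fun_cong[OF zero, of p] by (simp add: eval_bilin_def)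
      moreover have "g p (X p) (X p) > 0 \<or> g p (X p) (X p) < 0" if "X p \<noteq> 0"
        using def tan[OF X True] True that unfolding definite_def by blast
      ultimately show ?thesis by fastforce
    next
      case False
      then show ?thesis
        using X by (simp add: vector_fields_def)
    qed
  qed
  show "r = 0" if "r + r = 0" for r :: "'a \<Rightarrow> real"
  proof
    fix x
    show "r x = 0 x"
      using fun_cong[OF that, of x] by simp
  qed
qed

section \<open>Connections\<close>

lemma connection_closed:
  "connection M D \<Longrightarrow> X \<in> vector_fields M \<Longrightarrow> Y \<in> vector_fields M \<Longrightarrow> D X Y \<in> vector_fields M"
  unfolding connection_def by blast

lemma connection_diff:
  assumes "smooth_manifold M" "connection M D"
    and "X \<in> vector_fields M" "Y \<in> vector_fields M" "Z \<in> vector_fields M"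
  shows "D X (Y - Z) = D X Y - D X Z"
proof -
  have "\<forall>Y\<in>vector_fields M. \<forall>Z\<in>vector_fields M. D X (Y + Z) = D X Y + D X Z"
    using assms(2,3) unfolding connection_def by blast
  from this[rule_format, OF vector_fields_diff[OF assms(1,4,5)] assms(5)]
  show ?thesis by simp
qed

text \<open>On arguments that are not vector fields, connections are zero by convention.\<close>

lemma connection_eqI:
  assumes "connection M D" "connection M E"
    and "\<And>X Y. X \<in> vector_fields M \<Longrightarrow> Y \<in> vector_fields M \<Longrightarrow> D X Y = E X Y"
  shows "D = E"
proof (intro ext)
  fix X Y p f
  have "D X Y = E X Y"
  proof (cases "X \<in> vector_fields M \<and> Y \<in> vector_fields M")
    case True
    then show ?thesis
      using assms(3) by blast
  next
    case False
    then have "D X Y = 0" "E X Y = 0"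
      using assms(1,2) unfolding connection_def by blast+
    then show ?thesis by simp
  qed
  then show "D X Y p f = E X Y p f" by simp
qed

text \<open>Both torsion conditions have the same Lie bracket, which cancels.\<close>

lemma torsion_free_diff_commute:
  assumes "torsion_free M D" "torsion_free M E" "X \<in> vector_fields M" "Y \<in> vector_fields M"
  shows "D X Y - E X Y = D Y X - E Y X"
proof -
  have "D X Y - D Y X = E X Y - E Y X"
    using assms by (simp add: torsion_free_def)
  then show ?thesis
    by (simp add: algebra_simps)
qed

text \<open>The difference of two Levi-Civita connections is symmetric, by vanishing torsion, and
  skew for \<open>g\<close>, by metric compatibility. Uniqueness is what identifies the separate
  existential witnesses in the definitions.\<close>

lemma levi_civita_unique:
  fixes M :: "('a, 'e::euclidean_space) mfd"
  assumes H: "hermitian_module (vector_fields M) J (eval_bilin M g)"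
    and D: "levi_civita M g D" and E: "levi_civita M g E"
  shows "D = E"
proof (rule connection_eqI)
  interpret hermitian_module "vector_fields M" J "eval_bilin M g"
    by (rule H)
  show D_conn: "connection M D" and E_conn: "connection M E"
    using D E by (auto simp: levi_civita_def)
  have D_tf: "torsion_free M D" and E_tf: "torsion_free M E"
    using D E by (auto simp: levi_civita_def)
  fix X Y assume XY: "X \<in> vector_fields M" "Y \<in> vector_fields M"
  have "D X Y - E X Y = 0"
  proof (rule symmetric_skew_eq_zero[where T = "\<lambda>X Y. D X Y - E X Y", OF _ _ _ XY])
    fix X Y assume V: "X \<in> vector_fields M" "Y \<in> vector_fields M"
    show "D X Y - E X Y \<in> vector_fields M"
      by (intro V_diff connection_closed[OF D_conn] connection_closed[OF E_conn] V)
    show "D X Y - E X Y = D Y X - E Y X"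
      by (rule torsion_free_diff_commute[OF D_tf E_tf V])
  next
    fix X Y Z assume V: "X \<in> vector_fields M" "Y \<in> vector_fields M" "Z \<in> vector_fields M"
    note closed = connection_closed[OF D_conn] connection_closed[OF E_conn]
    have "cov_bilin M D g X Y Z = cov_bilin M E g X Y Z"
      using D E V by (simp add: levi_civita_def parallel_bilin_def)
    moreover have "eval_bilin M g Y (D X Z - E X Z) =
        eval_bilin M g Y (D X Z) - eval_bilin M g Y (E X Z)"
      using g_diff[of "D X Z" "E X Z" Y] g_commute[of Y] V_diff closed V by simp
    moreover have "eval_bilin M g (D X Y - E X Y) Z =
        eval_bilin M g (D X Y) Z - eval_bilin M g (E X Y) Z"
      using g_diff[of "D X Y" "E X Y" Z] closed V by simp
    ultimately show "eval_bilin M g (D X Y - E X Y) Z = - eval_bilin M g Y (D X Z - E X Z)"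
      by (simp only: cov_bilin_def) (simp add: fun_eq_iff algebra_simps)
  qed
  then show "D X Y = E X Y" by simp
qed

lemma special_kaehler_difference:
  fixes M :: "('a, 'e::euclidean_space) mfd"
  assumes M: "smooth_manifold M"
    and H: "hermitian_module (vector_fields M) (apply_endo M J) (eval_bilin M g)"
    and D: "levi_civita M g D" and DJ: "parallel_endo M D J"
    and N: "connection M N" "torsion_free M N" and N\<omega>: "parallel_bilin M N (kaehler_form g J)"
    and NJ: "\<And>X Y. X \<in> vector_fields M \<Longrightarrow> Y \<in> vector_fields M \<Longrightarrow>
               cov_endo M N J X Y = cov_endo M N J Y X"
  shows "special_hermitian_module (vector_fields M) (apply_endo M J) (eval_bilin M g)
           (\<lambda>X Y. N X Y - D X Y)"
proof -
  interpret hermitian_module "vector_fields M" "apply_endo M J" "eval_bilin M g"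
    by (rule H)
  have D_conn: "connection M D" and D_tf: "torsion_free M D" and Dg: "parallel_bilin M D g"
    using D by (auto simp: levi_civita_def)
  note closed = connection_closed[OF D_conn] connection_closed[OF N(1)]
  have D_J: "D X (apply_endo M J Y) = apply_endo M J (D X Y)"
    if "X \<in> vector_fields M" "Y \<in> vector_fields M" for X Y
    using DJ that by (simp add: parallel_endo_def cov_endo_def)
  show ?thesis
  proof
    fix X Y assume V: "X \<in> vector_fields M" "Y \<in> vector_fields M"
    show "N X Y - D X Y \<in> vector_fields M"
      by (intro V_diff closed V)
    show S_comm: "N X Y - D X Y = N Y X - D Y X"
      using torsion_free_diff_commute[OF N(2) D_tf V] .
    \<comment> \<open>As \<open>D\<close> commutes with \<open>J\<close>, this isolates the
      covariant derivative of \<open>J\<close>; for \<open>P\<close>, \<open>Q\<close> taken as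
      \<open>X\<close>, \<open>Y\<close>, both summands on the right are symmetric.\<close>
    have "N P (apply_endo M J Q) - D P (apply_endo M J Q) =
        cov_endo M N J P Q + apply_endo M J (N P Q - D P Q)"
      if "P \<in> vector_fields M" "Q \<in> vector_fields M" for P Q
      using D_J[OF that] J_diff[of "N P Q" "D P Q"] closed that by (simp add: cov_endo_def)
    then show "N X (apply_endo M J Y) - D X (apply_endo M J Y) =
        N Y (apply_endo M J X) - D Y (apply_endo M J X)"
      using V NJ[OF V] S_comm by simp
  next
    fix X Y Z assume V: "X \<in> vector_fields M" "Y \<in> vector_fields M" "Z \<in> vector_fields M"
    show "N X (Y - Z) - D X (Y - Z) = N X Y - D X Y - (N X Z - D X Z)"
      using connection_diff[OF M N(1) V] connection_diff[OF M D_conn V] by simp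
    let ?JY = "apply_endo M J Y"
    \<comment> \<open>Both sides vanish, and both differentiate the same function along
      \<open>X\<close>. Cancelling that term leaves exactly the symplectic condition on the
      difference.\<close>
    have "cov_bilin M N (kaehler_form g J) X Y Z = cov_bilin M D g X ?JY Z"
      using N\<omega> Dg V J_closed by (simp add: parallel_bilin_def)
    moreover have "eval_bilin M g ?JY (N X Z - D X Z) =
        eval_bilin M g ?JY (N X Z) - eval_bilin M g ?JY (D X Z)"
      using g_diff[of "N X Z" "D X Z" ?JY] g_commute[of ?JY] V_diff J_closed closed V by simp
    moreover have "eval_bilin M g (apply_endo M J (N X Y - D X Y)) Z =
        eval_bilin M g (apply_endo M J (N X Y)) Z - eval_bilin M g (apply_endo M J (D X Y)) Z"
      using J_diff[of "N X Y" "D X Y"] g_diff J_closed closed V by simp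
    moreover have "D X ?JY = apply_endo M J (D X Y)"
      by (rule D_J[OF V(1,2)])
    ultimately show "eval_bilin M g (apply_endo M J (N X Y - D X Y)) Z =
        - eval_bilin M g ?JY (N X Z - D X Z)"
      by (simp only: cov_bilin_def kaehler_form_eval) (simp add: fun_eq_iff algebra_simps)
  qed
qed

text \<open>The conclusion is \<open>S X (S Y Z) = S Y (S X Z)\<close> with \<open>S\<close>
  unfolded, as \<open>commuting_imp_zero\<close> requires.\<close>

lemma flat_difference_commutes:
  fixes M :: "('a, 'e::euclidean_space) mfd"
  assumes M: "smooth_manifold M"
    and S: "special_hermitian_module (vector_fields M) (apply_endo M J) (eval_bilin M g)
              (\<lambda>X Y. N X Y - D X Y)"
    and D: "connection M D" "torsion_free M D" "flat_connection M D"
    and DJ: "parallel_endo M D J"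
    and N: "connection M N" "flat_connection M N"
    and V: "X \<in> vector_fields M" "Y \<in> vector_fields M" "Z \<in> vector_fields M"
  shows "N X (N Y Z - D Y Z) - D X (N Y Z - D Y Z) = N Y (N X Z - D X Z) - D Y (N X Z - D X Z)"
proof -
  let ?V = "vector_fields M" and ?J = "apply_endo M J"
  define S where "S = (\<lambda>X Y. N X Y - D X Y)"
  interpret special_hermitian_module ?V ?J "eval_bilin M g" S
    using S by (simp add: S_def)
  let ?L = "lie_bracket M X Y"
  have L: "?L \<in> ?V"
  \<comment> \<open>Since \<open>D\<close> is torsion-free, the bracket is a difference of covariant
    derivatives, hence a vector field.\<close>
  proof -
    have "?L = D X Y - D Y X"
      using D(2) V by (simp add: torsion_free_def)
    then show ?thesis
      using V_diff connection_closed[OF D(1)] V by simp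
  qed
  note closed = connection_closed[OF D(1)] connection_closed[OF N(1)] S_closed J_closed V L
  have D_J: "D A (?J B) = ?J (D A B)" if "A \<in> ?V" "B \<in> ?V" for A B
    using DJ that by (simp add: parallel_endo_def cov_endo_def)
  have D_minus: "D A (- B) = - D A B" if "A \<in> ?V" "B \<in> ?V" for A B
    using connection_diff[OF M D(1), of A B B] connection_diff[OF M D(1), of A "B - B" B] that V_zero
    by simp
  \<comment> \<open>With \<open>N = D + S\<close>, the difference of the curvatures is
    \<open>E + B\<close>: \<open>E\<close> is the exterior covariant derivative of the
    endomorphism-valued one-form \<open>S\<close>, and \<open>B\<close> is the commutator of
    \<open>S X\<close> and \<open>S Y\<close>.\<close>
  define E where "E = (\<lambda>W. D X (S Y W) + S X (D Y W) - D Y (S X W) - S Y (D X W) - S ?L W)"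
  define B where "B = (\<lambda>W. S X (S Y W) - S Y (S X W))"
  have curv: "E W + B W = 0" if W: "W \<in> ?V" for W
  proof -
    have NN: "N P (N Q W) = D P (D Q W) + D P (S Q W) + S P (D Q W) + S P (S Q W)"
      if PQ: "P \<in> ?V" "Q \<in> ?V" for P Q
    proof -
      have "N P (N Q W) = D P (N Q W) + S P (N Q W)"
        by (simp add: S_def)
      moreover have "D P (S Q W) = D P (N Q W) - D P (D Q W)"
        using connection_diff[OF M D(1), of P "N Q W" "D Q W"] closed W PQ by (simp add: S_def)
      moreover have "S P (S Q W) = S P (N Q W) - S P (D Q W)"
        using S_diff[of P "N Q W" "D Q W"] closed W PQ by (simp add: S_def)
      ultimately show ?thesis
        by (simp add: algebra_simps)
    qed
    have "S ?L W = N ?L W - D ?L W"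
      by (simp add: S_def)
    then have "E W + B W = curvature M N X Y W - curvature M D X Y W"
      unfolding curvature_def NN[OF V(1,2)] NN[OF V(2,1)] E_def B_def
      by (simp add: algebra_simps)
    then show ?thesis
      using N(2) D(3) V W by (simp add: flat_connection_def)
  qed
  have E_in: "E W \<in> ?V" and B_in: "B W \<in> ?V" if "W \<in> ?V" for W
    using that closed V_diff V_add by (auto simp: E_def B_def)
  have J_add: "?J (P + Q) = ?J P + ?J Q" if "P \<in> ?V" "Q \<in> ?V" for P Q
    using J_diff[of P "- Q"] J_minus V_minus that by simp
  \<comment> \<open>Every term of \<open>E\<close> contains exactly one \<open>S\<close>, hence one
    sign when \<open>J\<close> passes through; the terms of \<open>B\<close> below contain
    two.\<close>
  have E_J: "E (?J Z) = - ?J (E Z)"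
  proof -
    have DS: "D P (S Q (?J Z)) = - ?J (D P (S Q Z))" and SD: "S P (D Q (?J Z)) = - ?J (S P (D Q Z))"
      if PQ: "P \<in> ?V" "Q \<in> ?V" for P Q
    proof -
      have "S Q Z \<in> ?V" "D Q Z \<in> ?V"
        using closed PQ by simp_all
      then show "D P (S Q (?J Z)) = - ?J (D P (S Q Z))" "S P (D Q (?J Z)) = - ?J (S P (D Q Z))"
        using S_J[of Q Z] D_J[of P "S Q Z"] D_minus[of P "?J (S Q Z)"]
          D_J[of Q Z] S_J[of P "D Q Z"] J_closed V PQ by simp_all
    qed
    have "?J (E Z) = ?J (D X (S Y Z)) + ?J (S X (D Y Z)) - ?J (D Y (S X Z)) - ?J (S Y (D X Z))
        - ?J (S ?L Z)"
      unfolding E_def by (simp add: J_add J_diff V_add V_diff closed)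
    then show ?thesis
      unfolding E_def DS[OF V(1,2)] DS[OF V(2,1)] SD[OF V(1,2)] SD[OF V(2,1)] S_J[OF L V(3)]
      by (simp only: minus_diff_eq minus_add_distrib) (simp add: algebra_simps)
  qed
  have B_J: "B (?J Z) = ?J (B Z)"
  proof -
    have "S P (S Q (?J Z)) = ?J (S P (S Q Z))" if PQ: "P \<in> ?V" "Q \<in> ?V" for P Q
      using S_J[of Q Z] S_minus[of P "?J (S Q Z)"] S_J[of P "S Q Z"] S_closed J_closed V PQ by simp
    then show ?thesis
      using J_diff[of "S X (S Y Z)" "S Y (S X Z)"] S_closed V by (simp add: B_def)
  qed
  \<comment> \<open>The identity \<open>curv\<close> is used twice: at \<open>Z\<close>, followed by
    \<open>J\<close>, and at \<open>J Z\<close>. Adding the results eliminates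
    \<open>E\<close>.\<close>
  have "?J (E Z) + ?J (B Z) = 0"
    using curv[OF V(3)] J_add[OF E_in B_in, OF V(3) V(3)] J_zero[OF V(1)] by simp
  moreover have "?J (B Z) - ?J (E Z) = 0"
    using curv[of "?J Z"] E_J B_J J_closed V by simp
  ultimately have "?J (B Z) + ?J (B Z) = 0"
    by simp
  from double_eq_zero[OF J_closed[OF B_in[OF V(3)]] this] have "B Z = 0"
    by (rule J_eq_zero[OF B_in[OF V(3)]])
  then show ?thesis
    by (simp add: B_def S_def)
qed

theorem theorem3:
  fixes M :: "('a, 'e::euclidean_space) mfd"
    and g :: "'a bilin_field" and J :: "'a endo_field" and N :: "'a conn"
  assumes "flat_special_kaehler_manifold M g J N"
    and "definite M g"
  shows "trivial_special_kaehler_manifold M g J N \<and> (\<forall>D. levi_civita M g D \<longrightarrow> N = D)"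
proof -
  have sk: "special_kaehler_manifold M g J N"
    using assms(1) by (simp add: flat_special_kaehler_manifold_def)
  then have M: "smooth_manifold M" and "metric M g" "almost_complex_structure M J" "hermitian M g J"
    and N: "connection M N" "torsion_free M N" "flat_connection M N"
    and N\<omega>: "parallel_bilin M N (kaehler_form g J)"
    and NJ: "\<And>X Y. X \<in> vector_fields M \<Longrightarrow> Y \<in> vector_fields M \<Longrightarrow>
               cov_endo M N J X Y = cov_endo M N J Y X"
    by (simp_all add: special_kaehler_manifold_def kaehler_manifold_def)
  then have H: "hermitian_module (vector_fields M) (apply_endo M J) (eval_bilin M g)"
    by (intro definite_hermitian_module assms(2))
  obtain D where D: "levi_civita M g D" and flat: "flat_connection M D"
    using assms(1) by (auto simp: flat_special_kaehler_manifold_def)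
  \<comment> \<open>Flatness and \<open>D J = 0\<close> are asserted for separately quantified
    connections; uniqueness merges \<open>D\<close> and \<open>D'\<close>.\<close>
  obtain D' where D': "levi_civita M g D'" and "parallel_endo M D' J"
    using sk by (auto simp: special_kaehler_manifold_def kaehler_manifold_def)
  then have DJ: "parallel_endo M D J"
    using levi_civita_unique[OF H D D'] by simp
  have D_conn: "connection M D" and D_tf: "torsion_free M D"
    using D by (auto simp: levi_civita_def)
  have S: "special_hermitian_module (vector_fields M) (apply_endo M J) (eval_bilin M g)
      (\<lambda>X Y. N X Y - D X Y)"
    using special_kaehler_difference[OF M H D DJ N(1,2) N\<omega> NJ] .
  have "N = D"
  proof (rule connection_eqI[OF N(1) D_conn])
    fix X Y assume XY: "X \<in> vector_fields M" "Y \<in> vector_fields M"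
    have "N X Y - D X Y = 0"
      by (rule special_hermitian_module.commuting_imp_zero[OF S _ XY])
        (rule flat_difference_commutes[OF M S D_conn D_tf flat DJ N(1,3)])
    then show "N X Y = D X Y" by simp
  qed
  then have "trivial_special_kaehler_manifold M g J N"
    unfolding trivial_special_kaehler_manifold_def using sk D flat by blast
  moreover have "N = D''" if "levi_civita M g D''" for D''
    using \<open>N = D\<close> levi_civita_unique[OF H D that] by (rule trans)
  ultimately show ?thesis by blast
qed

end
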